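(* Let $\boldsymbol X_a=(X_1^{(a)},\dots,X_r^{(a)})$, $a=1,\dots,n$, be i.i.d. from $\mu=\mu_1\otimes\cdots\otimes\mu_r$, where each $\mu_i$ is a Lebesgue absolutely continuous probability distribution on $\mathbb R^{d_i}$. Let $\boldsymbol C=(C_2,\dots,C_r)$ be a vector of nonnegative weights. Then the distribution of $\mathrm{RJdCov}_n^2(\boldsymbol X;\boldsymbol C)$ is universal, that is, it does not depend on $\mu_1,\dots,\mu_r$.
   Context: For each $i$, $\mathcal H_n^{d_i}=\{h_1^{d_i},\dots,h_n^{d_i}\}\subset[0,1]^{d_i}$ is a fixed grid (by default the Halton sequence). The empirical rank map is $\hat R_i(X_i^{(a)})=h^{d_i}_{\hat\sigma_i(a)}$, where $\hat\sigma_i$ minimizes $\sum_{a=1}^n\|X_i^{(a)}-h^{d_i}_{\sigma(a)}\|^2$ over all permutations $\sigma$ of $\{1,\dots,n\}$. Put $\mathrm dw_i=\dfrac{\mathrm dt_i}{c_{d_i}\|t_i\|^{1+d_i}}$ with $c_d=\pi^{(1+d)/2}/\Gamma((1+d)/2)$, $d_S=\sum_{i\in S}d_i$, $\iota=\sqrt{-1}$. For $S\subseteq\{1,\dots,r\}$ with $|S|\ge2$, $$\mathrm{RdCov}_n^2(\boldsymbol X_S)=\int_{\mathbb R^{d_S}}\left|\frac1n\sum_{b=1}^n\prod_{i\in S}\left(\frac1n\sum_{a=1}^ne^{\iota\langle t_i,\hat R_i(X_i^{(a)})\rangle}-e^{\iota\langle t_i,\hat R_i(X_i^{(b)})\rangle}\right)\right|^2\prod_{i\in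 S}\mathrm dw_i,$$ and $\mathrm{RJdCov}_n^2(\boldsymbol X;\boldsymbol C)=\sum_{s=2}^rC_s\sum_{S\subseteq\{1,\dots,r\},|S|=s}\mathrm{RdCov}_n^2(\boldsymbol X_S)$. *)

theory Defs
  imports "HOL-Probability.Probability" "HOL-Combinatorics.Permutations"
begin

text \<open>The dimensions \<open>d i\<close> vary with \<open>i\<close> inside one statement, so a point of \<open>\<real>\<^sup>d\<close> is an
  (extensional) function \<open>nat \<Rightarrow> real\<close> on the index set \<open>{..<d}\<close>.\<close>

text \<open>Lebesgue measure on the Borel sets of \<open>\<real>\<^sup>d\<close>; it also serves as the measurable space \<open>\<real>\<^sup>d\<close>.\<close>

definition lebesgue_R :: "nat \<Rightarrow> (nat \<Rightarrow> real) measure" where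
  "lebesgue_R d = PiM {..<d} (\<lambda>_. lborel)"

definition inner_R :: "nat \<Rightarrow> (nat \<Rightarrow> real) \<Rightarrow> (nat \<Rightarrow> real) \<Rightarrow> real" where
  "inner_R d x y = (\<Sum>k<d. x k * y k)"

definition norm_R :: "nat \<Rightarrow> (nat \<Rightarrow> real) \<Rightarrow> real" where
  "norm_R d x = sqrt (inner_R d x x)"

definition ac_distribution :: "nat \<Rightarrow> (nat \<Rightarrow> real) measure \<Rightarrow> bool" where
  "ac_distribution d \<mu> \<longleftrightarrow>
     prob_space \<mu> \<and> sets \<mu> = sets (lebesgue_R d) \<and> absolutely_continuous (lebesgue_R d) \<mu>"

text \<open>\<open>X a \<omega> i\<close> is the \<open>i\<close>-th block, in \<open>\<real>\<close> to the power \<open>d i\<close>, of the \<open>a\<close>-th observation.\<close>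

definition iid_product_sample ::
  "'a measure \<Rightarrow> nat \<Rightarrow> nat \<Rightarrow> (nat \<Rightarrow> nat) \<Rightarrow> (nat \<Rightarrow> (nat \<Rightarrow> real) measure) \<Rightarrow>
   (nat \<Rightarrow> 'a \<Rightarrow> nat \<Rightarrow> nat \<Rightarrow> real) \<Rightarrow> bool" where
  "iid_product_sample M n r d \<mu> X \<longleftrightarrow>
     prob_space M \<and>
     prob_space.indep_vars M (\<lambda>_. PiM {1..r} (\<lambda>i. lebesgue_R (d i))) X {1..n} \<and>
     (\<forall>a\<in>{1..n}. distr M (PiM {1..r} (\<lambda>i. lebesgue_R (d i))) (X a) = PiM {1..r} \<mu>)"

definition optimal_assignment ::
  "nat \<Rightarrow> nat \<Rightarrow> (nat \<Rightarrow> nat \<Rightarrow> real) \<Rightarrow> (nat \<Rightarrow> nat \<Rightarrow> real) \<Rightarrow> (nat \<Rightarrow> nat) \<Rightarrow> bool" where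
  "optimal_assignment d n h x \<sigma> \<longleftrightarrow>
     is_arg_min (\<lambda>\<tau>. \<Sum>a=1..n. (norm_R d (\<lambda>k. x a k - h (\<tau> a) k))\<^sup>2)
       (\<lambda>\<tau>. \<tau> permutes {1..n}) \<sigma>"

text \<open>A random minimizing permutation for each block. The minimizer may fail to be unique, so any
  measurable choice is admitted.\<close>

definition optimal_assignments ::
  "'a measure \<Rightarrow> nat \<Rightarrow> nat \<Rightarrow> (nat \<Rightarrow> nat) \<Rightarrow> (nat \<Rightarrow> nat \<Rightarrow> nat \<Rightarrow> real) \<Rightarrow>
   (nat \<Rightarrow> 'a \<Rightarrow> nat \<Rightarrow> nat \<Rightarrow> real) \<Rightarrow> (nat \<Rightarrow> 'a \<Rightarrow> nat \<Rightarrow> nat) \<Rightarrow> bool" where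
  "optimal_assignments M n r d h X \<sigma> \<longleftrightarrow>
     (\<forall>i\<in>{1..r}. \<sigma> i \<in> measurable M (count_space UNIV) \<and>
        (\<forall>\<omega>\<in>space M. optimal_assignment (d i) n (h (d i)) (\<lambda>a. X a \<omega> i) (\<sigma> i \<omega>)))"

definition dcov_const :: "nat \<Rightarrow> real" where
  "dcov_const d = pi powr ((1 + real d) / 2) / Gamma ((1 + real d) / 2)"

definition dcov_weight :: "nat \<Rightarrow> (nat \<Rightarrow> real) measure" where
  "dcov_weight d =
     density (lebesgue_R d) (\<lambda>t. ennreal (1 / (dcov_const d * norm_R d t ^ (1 + d))))"

text \<open>Here \<open>R i a\<close> is the empirical rank of the \<open>i\<close>-th block of the \<open>a\<close>-th observation.\<close>

definition RdCov2 ::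
  "nat \<Rightarrow> (nat \<Rightarrow> nat) \<Rightarrow> (nat \<Rightarrow> nat \<Rightarrow> nat \<Rightarrow> real) \<Rightarrow> nat set \<Rightarrow> real" where
  "RdCov2 n d R S =
     (LINT t | PiM S (\<lambda>i. dcov_weight (d i)).
        (cmod (1 / of_nat n * (\<Sum>b=1..n. \<Prod>i\<in>S.
           (1 / of_nat n * (\<Sum>a=1..n. exp (\<i> * of_real (inner_R (d i) (t i) (R i a))))
            - exp (\<i> * of_real (inner_R (d i) (t i) (R i b)))))))\<^sup>2)"

definition RJdCov2 ::
  "nat \<Rightarrow> nat \<Rightarrow> (nat \<Rightarrow> nat) \<Rightarrow> (nat \<Rightarrow> real) \<Rightarrow> (nat \<Rightarrow> nat \<Rightarrow> nat \<Rightarrow> real) \<Rightarrow> real" where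
  "RJdCov2 n r d C R =
     (\<Sum>s=2..r. C s * (\<Sum>S\<in>{S. S \<subseteq> {1..r} \<and> card S = s}. RdCov2 n d R S))"

text \<open>The statistic as a function on the sample space: the rank of the \<open>a\<close>-th observation in
  block \<open>i\<close> is the grid point to which the permutation \<open>\<sigma> i \<omega>\<close> assigns it.\<close>

definition RJdCov2_stat ::
  "nat \<Rightarrow> nat \<Rightarrow> (nat \<Rightarrow> nat) \<Rightarrow> (nat \<Rightarrow> nat \<Rightarrow> nat \<Rightarrow> real) \<Rightarrow> (nat \<Rightarrow> real) \<Rightarrow>
   (nat \<Rightarrow> 'a \<Rightarrow> nat \<Rightarrow> nat) \<Rightarrow> 'a \<Rightarrow> real" where
  "RJdCov2_stat n r d h C \<sigma> \<omega> = RJdCov2 n r d C (\<lambda>i a. h (d i) (\<sigma> i \<omega> a))"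

end

theory Submission
  imports Defs
begin

text \<open>Two assignments differ in cost by a linear functional of the data, because the squared norms of
  the grid points contribute equally to every permutation. So assignments with different rank
  vectors tie only on a hyperplane, which is null under an absolutely continuous product law, and the
  rank vector is almost surely unique even if the grid has repeated points. Permuting the \<open>n\<close>
  observations within each block, with a separate permutation for each block, preserves the product
  law and translates the optimal permutations on the right. Averaging over this finite group
  shows that the optimal permutations may be replaced by independent uniform ones, whatever the laws
  of the blocks.\<close>

section \<open>Null hyperplanes for product measures\<close>

text \<open>By Tonelli, the measure of the exceptional set is the integral of the measures of its
  sections along coordinate \<open>i\<close>, and each of these is null.\<close>

lemma AE_PiM_updateI:
  assumes fin: "finite I" and i: "i \<in> I"
    and sf: "\<And>j. j \<in> I \<Longrightarrow> sigma_finite_measure (M j)"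
    and P: "{x \<in> space (PiM I M). P x} \<in> sets (PiM I M)"
    and AE: "\<And>x. x \<in> space (PiM (I - {i}) M) \<Longrightarrow> AE y in M i. P (x(i := y))"
  shows "AE x in PiM I M. P x"
proof -
  \<comment> \<open>Sigma-finiteness is given only for indices in \<open>I\<close>, while
    \<open>product_sigma_finite\<close> asks for it at every index. Off \<open>I\<close> a one-point
    counting measure is put in, which leaves the product over \<open>I\<close> unchanged.\<close>
  define M' where "M' j = (if j \<in> I then M j else count_space {undefined})" for j
  have "sigma_finite_measure (M' j)" for j
    by (cases "j \<in> I") (simp_all add: M'_def sf sigma_finite_measure_count_space_finite)
  then interpret product_sigma_finite M'
    by (rule product_sigma_finite.intro)
  have eq: "PiM I M' = PiM I M" "PiM (I - {i}) M' = PiM (I - {i}) M" "M' i = M i"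
    by (rule PiM_cong; simp add: M'_def)+ (simp add: M'_def i)
  have I: "insert i (I - {i}) = I"
    using i by auto
  define f where "f = (indicator {x \<in> space (PiM I M'). \<not> P x} :: _ \<Rightarrow> ennreal)"
  have nP: "{x \<in> space (PiM I M'). \<not> P x} \<in> sets (PiM I M')"
    using sets.sets_Collect_neg[OF P] by (simp add: eq)
  have f: "f \<in> borel_measurable (PiM I M')"
    unfolding f_def using nP by simp
  have z: "(\<integral>\<^sup>+ y. f (x(i := y)) \<partial>M' i) = 0" if "x \<in> space (PiM (I - {i}) M')" for x
  proof -
    have "(\<integral>\<^sup>+ y. f (x(i := y)) \<partial>M' i) = (\<integral>\<^sup>+ y. 0 \<partial>M' i)"
      using AE[of x] that unfolding eq f_def
      by (intro nn_integral_cong_AE) (auto simp: indicator_def)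
    then show ?thesis by simp
  qed
  have "emeasure (PiM I M') {x \<in> space (PiM I M'). \<not> P x} = integral\<^sup>N (PiM I M') f"
    unfolding f_def using nP by simp
  also have "\<dots> = (\<integral>\<^sup>+ x. (\<integral>\<^sup>+ y. f (x(i := y)) \<partial>M' i) \<partial>PiM (I - {i}) M')"
    using product_nn_integral_insert[of "I - {i}" i f, unfolded I] fin f by simp
  also have "\<dots> = (\<integral>\<^sup>+ x. 0 \<partial>PiM (I - {i}) M')"
    by (intro nn_integral_cong z)
  finally have "emeasure (PiM I M') {x \<in> space (PiM I M'). \<not> P x} = 0"
    by simp
  with nP have "AE x in PiM I M'. P x"
    by (intro AE_I'[of "{x \<in> space (PiM I M'). \<not> P x}"]) (auto simp: null_sets_def)
  then show ?thesis unfolding eq(1) .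
qed

text \<open>With the other coordinates frozen, the sum is affine in \<open>x k\<close> with slope
  \<open>c k \<noteq> 0\<close>. It takes the value \<open>b\<close> at a single point, and points
  are Lebesgue null.\<close>

lemma AE_lebesgue_R_hyperplane:
  assumes k: "k < d" "c k \<noteq> 0"
  shows "AE x in lebesgue_R d. (\<Sum>k<d. x k * c k) \<noteq> b"
  unfolding lebesgue_R_def
proof (rule AE_PiM_updateI[where i = k])
  fix x
  have "(\<Sum>j<d. (x(k := y)) j * c j) = y * c k + (\<Sum>j\<in>{..<d} - {k}. x j * c j)" for y
    using k by (subst sum.remove[of _ k]) (auto intro!: sum.cong)
  then have "(\<Sum>j<d. (x(k := y)) j * c j) \<noteq> b"
    if "y \<noteq> (b - (\<Sum>j\<in>{..<d} - {k}. x j * c j)) / c k" for y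
    using that k by (auto simp: field_simps)
  then show "AE y in lborel. (\<Sum>j<d. (x(k := y)) j * c j) \<noteq> b"
    by (rule eventually_mono[OF AE_lborel_singleton])
next
  have "(\<lambda>x. \<Sum>k<d. x k * c k) \<in> borel_measurable (PiM {..<d} (\<lambda>_. lborel))"
    by (intro borel_measurable_sum borel_measurable_times borel_measurable_const
        measurable_component_singleton[where M = "\<lambda>_. lborel", simplified])
  then show "{x \<in> space (PiM {..<d} (\<lambda>_. lborel)). (\<Sum>k<d. x k * c k) \<noteq> b} \<in> sets (PiM {..<d} (\<lambda>_. lborel))"
    by measurable
qed (use k in \<open>simp_all add: lborel.sigma_finite_measure_axioms\<close>)

lemma sets_ac_distribution: "ac_distribution d \<mu> \<Longrightarrow> sets \<mu> = sets (lebesgue_R d)"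
  by (simp add: ac_distribution_def)

lemma measurable_block_coordinate:
  fixes r :: nat
  assumes i: "i \<in> {1..r}" and sets: "sets (\<mu> i) = sets (lebesgue_R d)"
    and a: "a \<in> {1..n}" and k: "k < d"
  shows "(\<lambda>z. z (a, i) k) \<in> borel_measurable (PiM ({1..n} \<times> {1..r}) (\<lambda>p. \<mu> (snd p)))"
proof (rule measurable_compose[where f = "\<lambda>z. z (a, i)" and g = "\<lambda>x. x k"])
  show "(\<lambda>z. z (a, i)) \<in> measurable (PiM ({1..n} \<times> {1..r}) (\<lambda>p. \<mu> (snd p))) (\<mu> i)"
    using measurable_component_singleton[of "(a, i)" "{1..n} \<times> {1..r}" "\<lambda>p. \<mu> (snd p)"] a i by simp
  have "(\<lambda>x. x k) \<in> measurable (PiM {..<d} (\<lambda>_. lborel)) lborel"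
    using k by (intro measurable_component_singleton) simp
  then show "(\<lambda>x. x k) \<in> borel_measurable (\<mu> i)"
    using sets unfolding lebesgue_R_def by (simp cong: measurable_cong_sets)
qed

text \<open>With every block except \<open>(a, i)\<close> frozen, the functional vanishes only if
  that block lies on a hyperplane with normal \<open>c a\<close>, which is nonzero. This set is null
  for Lebesgue measure, hence for \<open>\<mu> i\<close> by absolute continuity.\<close>

lemma AE_block_functional_nonzero:
  fixes c :: "nat \<Rightarrow> nat \<Rightarrow> real" and r :: nat
  assumes \<mu>: "\<And>i. i \<in> {1..r} \<Longrightarrow> ac_distribution (d i) (\<mu> i)"
    and i: "i \<in> {1..r}" and a: "a \<in> {1..n}" and k: "k < d i" and c: "c a k \<noteq> 0"
  shows "AE z in PiM ({1..n} \<times> {1..r}) (\<lambda>p. \<mu> (snd p)).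
           (\<Sum>a=1..n. \<Sum>k<d i. z (a, i) k * c a k) \<noteq> 0"
proof (rule AE_PiM_updateI[where i = "(a, i)"])
  fix j assume "j \<in> {1..n} \<times> {1..r}"
  then have "snd j \<in> {1..r}" by auto
  then show "sigma_finite_measure (\<mu> (snd j))"
    using \<mu>[of "snd j"] prob_space_imp_sigma_finite unfolding ac_distribution_def by blast
next
  have "(\<lambda>z. \<Sum>a=1..n. \<Sum>k<d i. z (a, i) k * c a k) \<in>
      borel_measurable (PiM ({1..n} \<times> {1..r}) (\<lambda>p. \<mu> (snd p)))"
    by (intro borel_measurable_sum borel_measurable_times borel_measurable_const
        measurable_block_coordinate[where \<mu> = \<mu>, OF i sets_ac_distribution[OF \<mu>[OF i]]]) simp_all
  then show "{z \<in> space (PiM ({1..n} \<times> {1..r}) (\<lambda>p. \<mu> (snd p))).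
      (\<Sum>a=1..n. \<Sum>k<d i. z (a, i) k * c a k) \<noteq> 0} \<in> sets (PiM ({1..n} \<times> {1..r}) (\<lambda>p. \<mu> (snd p)))"
    by measurable
next
  fix z
  let ?s = "\<Sum>b\<in>{1..n} - {a}. \<Sum>k<d i. z (b, i) k * c b k"
  have eq: "(\<Sum>b=1..n. \<Sum>k<d i. (z((a, i) := y)) (b, i) k * c b k) = (\<Sum>k<d i. y k * c a k) + ?s" for y
    using a by (subst sum.remove[of _ a]) (auto intro!: sum.cong)
  have "AE y in \<mu> i. (\<Sum>k<d i. y k * c a k) \<noteq> - ?s"
    using \<mu>[OF i] AE_lebesgue_R_hyperplane[OF k, of "c a" "- ?s"] c
    by (auto simp: ac_distribution_def intro: absolutely_continuous_AE)
  then show "AE y in \<mu> (snd (a, i)). (\<Sum>b=1..n. \<Sum>k<d i. (z((a, i) := y)) (b, i) k * c b k) \<noteq> 0"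
    by (simp only: eq snd_conv) (auto elim: eventually_mono)
qed (use a i in auto)

section \<open>Assignment costs and almost sure uniqueness of the ranks\<close>

lemma norm_R_power2: "(norm_R d x)\<^sup>2 = (\<Sum>k<d. (x k)\<^sup>2)"
proof -
  have "0 \<le> (\<Sum>k<d. (x k)\<^sup>2)" by (intro sum_nonneg) auto
  then show ?thesis
    by (simp add: norm_R_def inner_R_def power2_eq_square)
qed

text \<open>Expanding the squares leaves only the cross terms. They enter the cost with a minus
  sign, so \<open>\<tau>'\<close> comes first on the right.\<close>

lemma assignment_cost_diff:
  assumes "\<tau> permutes {1..n}" "\<tau>' permutes {1..n}"
  shows "(\<Sum>a=1..n. (norm_R d (\<lambda>k. x a k - h (\<tau> a) k))\<^sup>2)
       - (\<Sum>a=1..n. (norm_R d (\<lambda>k. x a k - h (\<tau>' a) k))\<^sup>2)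
       = 2 * (\<Sum>a=1..n. \<Sum>k<d. x a k * (h (\<tau>' a) k - h (\<tau> a) k))"
proof -
  have *: "(\<Sum>a=1..n. (norm_R d (\<lambda>k. x a k - h (\<rho> a) k))\<^sup>2) =
     (\<Sum>a=1..n. \<Sum>k<d. (x a k)\<^sup>2) + (\<Sum>a=1..n. \<Sum>k<d. (h a k)\<^sup>2) - 2 * (\<Sum>a=1..n. \<Sum>k<d. x a k * h (\<rho> a) k)"
    if "\<rho> permutes {1..n}" for \<rho>
  proof -
    have "(\<Sum>a=1..n. \<Sum>k<d. (h a k)\<^sup>2) = (\<Sum>a=1..n. \<Sum>k<d. (h (\<rho> a) k)\<^sup>2)"
      using sum.permute[OF that, of "\<lambda>a. \<Sum>k<d. (h a k)\<^sup>2"] by (simp add: o_def)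
    then show ?thesis
      by (simp add: norm_R_power2 power2_diff sum.distrib sum_subtractf sum_distrib_left mult.assoc)
  qed
  show ?thesis
    by (simp add: *[OF assms(1)] *[OF assms(2)] right_diff_distrib sum_subtractf)
qed

lemma optimal_assignment_tie:
  assumes "optimal_assignment d n h x \<tau>" "optimal_assignment d n h x \<tau>'"
  shows "(\<Sum>a=1..n. \<Sum>k<d. x a k * (h (\<tau>' a) k - h (\<tau> a) k)) = 0"
proof -
  have "\<tau> permutes {1..n}" "\<tau>' permutes {1..n}"
    and "(\<Sum>a=1..n. (norm_R d (\<lambda>k. x a k - h (\<tau> a) k))\<^sup>2) = (\<Sum>a=1..n. (norm_R d (\<lambda>k. x a k - h (\<tau>' a) k))\<^sup>2)"
    using assms unfolding optimal_assignment_def is_arg_min_linorder by (auto intro!: antisym)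
  with assignment_cost_diff[of \<tau> n \<tau>' d x h] show ?thesis by simp
qed

text \<open>A point of the canonical space carries block \<open>i\<close> of observation \<open>a\<close> in its coordinate
  \<open>(a, i)\<close>.\<close>

definition optimal_family ::
  "nat \<Rightarrow> nat \<Rightarrow> (nat \<Rightarrow> nat) \<Rightarrow> (nat \<Rightarrow> nat \<Rightarrow> nat \<Rightarrow> real) \<Rightarrow> (nat \<times> nat \<Rightarrow> nat \<Rightarrow> real) \<Rightarrow>
   (nat \<Rightarrow> nat \<Rightarrow> nat) \<Rightarrow> bool" where
  "optimal_family n r d h z \<tau> \<longleftrightarrow>
     (\<forall>i\<in>{1..r}. optimal_assignment (d i) n (h (d i)) (\<lambda>a. z (a, i)) (\<tau> i))"

text \<open>Uniqueness is asked of the assigned grid points, not of the permutations: a grid with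
  repeated points allows several optimal permutations with the same ranks. The coordinates below
  \<open>d i\<close> are those that the inner products read.\<close>

definition unique_optimal_ranks ::
  "nat \<Rightarrow> nat \<Rightarrow> (nat \<Rightarrow> nat) \<Rightarrow> (nat \<Rightarrow> nat \<Rightarrow> nat \<Rightarrow> real) \<Rightarrow> (nat \<times> nat \<Rightarrow> nat \<Rightarrow> real) \<Rightarrow> bool" where
  "unique_optimal_ranks n r d h z \<longleftrightarrow>
     (\<forall>\<tau> \<tau>'. optimal_family n r d h z \<tau> \<longrightarrow> optimal_family n r d h z \<tau>' \<longrightarrow>
        (\<forall>i\<in>{1..r}. \<forall>a\<in>{1..n}. \<forall>k<d i. h (d i) (\<tau> i a) k = h (d i) (\<tau>' i a) k))"

text \<open>For a pair of permutations, a coordinate \<open>(a, k)\<close> at which the assigned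
  grid points differ supplies the nonzero coefficient of a hyperplane. Blocks, pairs and coordinates
  are finite in number, so the exceptional null sets can be united.\<close>

lemma AE_optimal_ranks_unique:
  fixes r :: nat
  assumes \<mu>: "\<And>i. i \<in> {1..r} \<Longrightarrow> ac_distribution (d i) (\<mu> i)"
  shows "AE z in PiM ({1..n} \<times> {1..r}) (\<lambda>p. \<mu> (snd p)). unique_optimal_ranks n r d h z"
    (is "AE z in ?\<nu>. _")
proof -
  let ?P = "{\<tau>. \<tau> permutes {1..n}}"
  have "AE z in ?\<nu>. \<forall>i\<in>{1..r}. \<forall>\<tau>\<in>?P. \<forall>\<tau>'\<in>?P. \<forall>a\<in>{1..n}. \<forall>k\<in>{..<d i}.
      h (d i) (\<tau>' a) k - h (d i) (\<tau> a) k \<noteq> 0 \<longrightarrow>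
      (\<Sum>a=1..n. \<Sum>k<d i. z (a, i) k * (h (d i) (\<tau>' a) k - h (d i) (\<tau> a) k)) \<noteq> 0"
  proof (intro AE_finite_allI finite_permutations finite_atLeastAtMost finite_lessThan AE_impI)
    fix i \<tau> \<tau>' a k
    assume "i \<in> {1..r}" "a \<in> {1..n}" "k \<in> {..<d i}" "h (d i) (\<tau>' a) k - h (d i) (\<tau> a) k \<noteq> 0"
    then show "AE z in ?\<nu>. (\<Sum>a=1..n. \<Sum>k<d i. z (a, i) k * (h (d i) (\<tau>' a) k - h (d i) (\<tau> a) k)) \<noteq> 0"
      by (intro AE_block_functional_nonzero[where a = a and k = k and
            c = "\<lambda>a k. h (d i) (\<tau>' a) k - h (d i) (\<tau> a) k"] \<mu>) auto
  qed
  then show ?thesis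
  proof eventually_elim
    fix z
    assume *: "\<forall>i\<in>{1..r}. \<forall>\<tau>\<in>?P. \<forall>\<tau>'\<in>?P. \<forall>a\<in>{1..n}. \<forall>k\<in>{..<d i}.
      h (d i) (\<tau>' a) k - h (d i) (\<tau> a) k \<noteq> 0 \<longrightarrow>
      (\<Sum>a=1..n. \<Sum>k<d i. z (a, i) k * (h (d i) (\<tau>' a) k - h (d i) (\<tau> a) k)) \<noteq> 0"
    show "unique_optimal_ranks n r d h z"
      unfolding unique_optimal_ranks_def
    proof (intro ballI allI impI)
      fix \<tau> \<tau>' i a k
      assume "optimal_family n r d h z \<tau>" "optimal_family n r d h z \<tau>'"
        and i: "i \<in> {1..r}" and a: "a \<in> {1..n}" and k: "k < d i"
      then have opt: "optimal_assignment (d i) n (h (d i)) (\<lambda>a. z (a, i)) (\<tau> i)"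
          "optimal_assignment (d i) n (h (d i)) (\<lambda>a. z (a, i)) (\<tau>' i)"
        unfolding optimal_family_def by blast+
      have "\<tau> i \<in> ?P" "\<tau>' i \<in> ?P"
        using opt by (auto simp: optimal_assignment_def is_arg_min_def)
      \<comment> \<open>If the ranks differed at \<open>(a, k)\<close>, the functional would be
        nonzero at \<open>z\<close>, whereas a tie between two minimizers makes it zero.\<close>
      with *[rule_format, OF i this a, of k] k optimal_assignment_tie[OF opt]
      show "h (d i) (\<tau> i a) k = h (d i) (\<tau>' i a) k"
        by (cases "h (d i) (\<tau>' i a) k - h (d i) (\<tau> i a) k = 0") simp_all
    qed
  qed
qed

section \<open>Optimal assignments of relabelled data\<close>

text \<open>Reindexing the sum shows that \<open>\<rho> \<circ> \<pi>\<close> costs on the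
  relabelled data what \<open>\<rho>\<close> costs on the original. Right translation by
  \<open>\<pi>\<close> permutes the candidates, so it carries minimizers to minimizers.\<close>

lemma optimal_assignment_permute:
  assumes \<pi>: "\<pi> permutes {1..n}"
    and x': "\<And>a. a \<in> {1..n} \<Longrightarrow> x' a = x (\<pi> a)"
    and opt: "optimal_assignment d n h x \<tau>"
  shows "optimal_assignment d n h x' (\<tau> \<circ> \<pi>)"
proof -
  have *: "(\<Sum>a=1..n. (norm_R d (\<lambda>k. x' a k - h (\<rho> (\<pi> a)) k))\<^sup>2) =
      (\<Sum>a=1..n. (norm_R d (\<lambda>k. x a k - h (\<rho> a) k))\<^sup>2)" for \<rho>
    using sum.permute[OF \<pi>, of "\<lambda>a. (norm_R d (\<lambda>k. x a k - h (\<rho> a) k))\<^sup>2"] by (simp add: x')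
  have "(\<Sum>a=1..n. (norm_R d (\<lambda>k. x a k - h (\<tau> a) k))\<^sup>2) \<le>
      (\<Sum>a=1..n. (norm_R d (\<lambda>k. x' a k - h (\<rho> a) k))\<^sup>2)" if "\<rho> permutes {1..n}" for \<rho>
  proof -
    \<comment> \<open>A competitor \<open>\<rho>\<close> for the relabelled data corresponds to
      \<open>\<rho> \<circ> inv \<pi>\<close> for the original data.\<close>
    have "(\<rho> \<circ> inv \<pi>) permutes {1..n}"
      using that \<pi> permutes_inv permutes_compose by blast
    then have "(\<Sum>a=1..n. (norm_R d (\<lambda>k. x a k - h (\<tau> a) k))\<^sup>2) \<le>
        (\<Sum>a=1..n. (norm_R d (\<lambda>k. x a k - h ((\<rho> \<circ> inv \<pi>) a) k))\<^sup>2)"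
      using opt unfolding optimal_assignment_def is_arg_min_linorder by blast
    also have "\<dots> = (\<Sum>a=1..n. (norm_R d (\<lambda>k. x' a k - h (\<rho> a) k))\<^sup>2)"
      unfolding *[of "\<rho> \<circ> inv \<pi>", symmetric] using permutes_inverses(2)[OF \<pi>] by simp
    finally show ?thesis .
  qed
  moreover have "(\<tau> \<circ> \<pi>) permutes {1..n}"
    using opt \<pi> permutes_compose unfolding optimal_assignment_def is_arg_min_def by blast
  ultimately show ?thesis
    unfolding optimal_assignment_def is_arg_min_linorder comp_apply * by blast
qed

text \<open>The converse is the forward implication for the relabelling
  \<open>inv \<pi>\<close>.\<close>

lemma optimal_assignment_permute_iff:
  assumes \<pi>: "\<pi> permutes {1..n}"
    and x': "\<And>a. a \<in> {1..n} \<Longrightarrow> x' a = x (\<pi> a)"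
  shows "optimal_assignment d n h x' (\<tau> \<circ> \<pi>) \<longleftrightarrow> optimal_assignment d n h x \<tau>"
proof
  assume "optimal_assignment d n h x' (\<tau> \<circ> \<pi>)"
  moreover have "x a = x' (inv \<pi> a)" if "a \<in> {1..n}" for a
    using x'[of "inv \<pi> a"] that permutes_inverses(1)[OF \<pi>] permutes_in_image[OF permutes_inv[OF \<pi>]]
    by simp
  ultimately have "optimal_assignment d n h x ((\<tau> \<circ> \<pi>) \<circ> inv \<pi>)"
    by (intro optimal_assignment_permute[OF permutes_inv[OF \<pi>]]) auto
  then show "optimal_assignment d n h x \<tau>"
    using permutes_inv_o(1)[OF \<pi>] by (simp add: o_assoc[symmetric])
qed (use optimal_assignment_permute assms in blast)

lemma optimal_assignment_cong:
  assumes "\<And>a. a \<in> {1..n} \<Longrightarrow> x a = x' a"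
  shows "optimal_assignment d n h x \<tau> \<longleftrightarrow> optimal_assignment d n h x' \<tau>"
  using optimal_assignment_permute_iff[OF permutes_id, of n x x' d h \<tau>] assms by simp

lemma optimal_assignment_exists: "\<exists>\<tau>. optimal_assignment d n h x \<tau>"
proof -
  have "finite {\<tau>. \<tau> permutes {1..n}}" "{\<tau>. \<tau> permutes {1..n}} \<noteq> {}"
    using finite_permutations[of "{1..n}"] permutes_id[of "{1..n}"] by blast+
  from ex_is_arg_min_if_finite[OF this] show ?thesis
    unfolding optimal_assignment_def mem_Collect_eq by blast
qed

section \<open>The statistic as a function of the ranks\<close>

text \<open>Ranks enter only through inner products over the coordinates below \<open>d i\<close>.
  The integrands agree at every \<open>t\<close>, so no question of integrability arises.\<close>

lemma RJdCov2_cong: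
  assumes "\<And>i a k. i \<in> {1..r} \<Longrightarrow> a \<in> {1..n} \<Longrightarrow> k < d i \<Longrightarrow> R i a k = R' i a k"
  shows "RJdCov2 n r d C R = RJdCov2 n r d C R'"
proof -
  have "inner_R (d i) t (R i a) = inner_R (d i) t (R' i a)" if "i \<in> {1..r}" "a \<in> {1..n}" for i a t
    unfolding inner_R_def using that assms by (intro sum.cong) auto
  then have "RdCov2 n d R S = RdCov2 n d R' S" if "S \<subseteq> {1..r}" for S
    unfolding RdCov2_def using that
    by (intro Bochner_Integration.integral_cong refl arg_cong[where f = "\<lambda>x. (cmod x)\<^sup>2"]
        arg_cong2[where f = "(*)"] sum.cong prod.cong arg_cong2[where f = "(-)"] arg_cong[where f = exp])
      (auto dest: subsetD)
  then show ?thesis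
    unfolding RJdCov2_def by (intro sum.cong arg_cong2[where f = "(*)"] refl) auto
qed

section \<open>Law of the array of sample blocks\<close>

text \<open>The cells of the array are independent: across observations by the sampling assumption,
  across blocks by the product form of the common law. It suffices to compute the probability of
  boxes, first splitting over \<open>a\<close> by independence, then over \<open>i\<close> by the
  product law.\<close>

lemma
  assumes X: "iid_product_sample M n r d \<mu> X" and n: "n \<ge> 1"
    and prob: "\<And>i. prob_space (\<mu> i)"
    and sets: "\<And>i. i \<in> {1..r} \<Longrightarrow> sets (\<mu> i) = sets (lebesgue_R (d i))"
  shows measurable_sample_blocks:
      "(\<lambda>\<omega>. \<lambda>p\<in>{1..n} \<times> {1..r}. X (fst p) \<omega> (snd p)) \<in>
         measurable M (PiM ({1..n} \<times> {1..r}) (\<lambda>p. \<mu> (snd p)))" (is ?meas)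
    and distr_sample_blocks:
      "distr M (PiM ({1..n} \<times> {1..r}) (\<lambda>p. \<mu> (snd p)))
         (\<lambda>\<omega>. \<lambda>p\<in>{1..n} \<times> {1..r}. X (fst p) \<omega> (snd p)) =
       PiM ({1..n} \<times> {1..r}) (\<lambda>p. \<mu> (snd p))" (is ?distr)
proof -
  interpret M: prob_space M using X by (simp add: iid_product_sample_def)
  interpret \<mu>: product_prob_space \<mu> "{1..r}"
    by (intro product_prob_spaceI prob)
  interpret blocks: product_prob_space "\<lambda>p. \<mu> (snd p)" "{1..n} \<times> {1..r}"
    by (intro product_prob_spaceI prob)
  have sets_PiM: "sets (PiM {1..r} (\<lambda>i. lebesgue_R (d i))) = sets (PiM {1..r} \<mu>)"
    by (intro sets_PiM_cong) (auto simp: sets)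
  have indep: "M.indep_vars (\<lambda>_. PiM {1..r} (\<lambda>i. lebesgue_R (d i))) X {1..n}"
    and law: "\<And>a. a \<in> {1..n} \<Longrightarrow> distr M (PiM {1..r} (\<lambda>i. lebesgue_R (d i))) (X a) = PiM {1..r} \<mu>"
    using X by (auto simp: iid_product_sample_def)
  have Xm: "X a \<in> measurable M (PiM {1..r} (\<lambda>i. lebesgue_R (d i)))" if "a \<in> {1..n}" for a
    using indep that by (auto simp: M.indep_vars_def2)
  have Xm': "X a \<in> measurable M (PiM {1..r} \<mu>)" if "a \<in> {1..n}" for a
    using Xm[OF that] measurable_cong_sets[OF refl sets_PiM] by blast
  show meas: ?meas
  proof (rule measurable_restrict)
    fix p assume p: "p \<in> {1..n} \<times> {1..r}"
    then have "fst p \<in> {1..n}" "snd p \<in> {1..r}"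
      by (auto simp only: mem_Times_iff)
    then show "(\<lambda>\<omega>. X (fst p) \<omega> (snd p)) \<in> measurable M (\<mu> (snd p))"
      using measurable_compose[OF Xm' measurable_component_singleton] by blast
  qed
  show ?distr
  proof (rule blocks.PiM_eqI)
    fix A assume A: "\<And>p. p \<in> {1..n} \<times> {1..r} \<Longrightarrow> A p \<in> sets (\<mu> (snd p))"
    have box: "PiE {1..r} (\<lambda>i. A (a, i)) \<in> sets (PiM {1..r} \<mu>)" if "a \<in> {1..n}" for a
      using A that by (intro sets_PiM_I_finite) force+
    have box': "PiE {1..r} (\<lambda>i. A (a, i)) \<in> sets (PiM {1..r} (\<lambda>i. lebesgue_R (d i)))" if "a \<in> {1..n}" for a
      using box[OF that] sets_PiM by simp
    \<comment> \<open>A box in \<open>PiE\<close> also demands the value \<open>undefined\<close>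
      outside \<open>{1..r}\<close>, which the array does not record; it holds because
      \<open>X a \<omega>\<close> is a point of the product space.\<close>
    have ext: "X a \<omega> \<in> extensional {1..r}" if "a \<in> {1..n}" "\<omega> \<in> space M" for a \<omega>
      using measurable_space[OF Xm[OF that(1)] that(2)] by (auto simp: space_PiM PiE_def)
    \<comment> \<open>Here \<open>n \<ge> 1\<close> matters: an empty intersection would be the
      whole type instead of \<open>space M\<close>.\<close>
    have "(\<lambda>\<omega>. \<lambda>p\<in>{1..n} \<times> {1..r}. X (fst p) \<omega> (snd p)) -` PiE ({1..n} \<times> {1..r}) A \<inter> space M =
        (\<Inter>a\<in>{1..n}. X a -` PiE {1..r} (\<lambda>i. A (a, i)) \<inter> space M)"
      using ext n by (fastforce simp: PiE_iff)
    then have "emeasure (distr M (PiM ({1..n} \<times> {1..r}) (\<lambda>p. \<mu> (snd p)))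
        (\<lambda>\<omega>. \<lambda>p\<in>{1..n} \<times> {1..r}. X (fst p) \<omega> (snd p))) (PiE ({1..n} \<times> {1..r}) A) =
        M.prob (\<Inter>a\<in>{1..n}. X a -` PiE {1..r} (\<lambda>i. A (a, i)) \<inter> space M)"
      using A by (subst emeasure_distr[OF meas]) (auto intro!: sets_PiM_I_finite simp: M.emeasure_eq_measure)
    also have "\<dots> = (\<Prod>a=1..n. M.prob (X a -` PiE {1..r} (\<lambda>i. A (a, i)) \<inter> space M))"
      using box' n by (subst M.indep_varsD_finite[OF indep]) auto
    also have "\<dots> = (\<Prod>a=1..n. emeasure M (X a -` PiE {1..r} (\<lambda>i. A (a, i)) \<inter> space M))"
      by (simp add: M.emeasure_eq_measure prod_ennreal)
    also have "\<dots> = (\<Prod>a=1..n. emeasure (PiM {1..r} \<mu>) (PiE {1..r} (\<lambda>i. A (a, i))))"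
    proof (rule prod.cong[OF refl])
      fix a assume a: "a \<in> {1..n}"
      show "emeasure M (X a -` PiE {1..r} (\<lambda>i. A (a, i)) \<inter> space M) =
          emeasure (PiM {1..r} \<mu>) (PiE {1..r} (\<lambda>i. A (a, i)))"
        using emeasure_distr[OF Xm[OF a] box'[OF a]] law[OF a] by simp
    qed
    also have "\<dots> = (\<Prod>a=1..n. \<Prod>i=1..r. emeasure (\<mu> i) (A (a, i)))"
    proof (intro prod.cong refl \<mu>.emeasure_PiM)
      fix a i assume "a \<in> {1..n}" "i \<in> {1..r}"
      then show "A (a, i) \<in> sets (\<mu> i)" using A[of "(a, i)"] by auto
    qed auto
    also have "\<dots> = (\<Prod>p\<in>{1..n} \<times> {1..r}. emeasure (\<mu> (snd p)) (A p))"
      by (simp add: prod.cartesian_product case_prod_beta')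
    finally show "emeasure (distr M (PiM ({1..n} \<times> {1..r}) (\<lambda>p. \<mu> (snd p)))
        (\<lambda>\<omega>. \<lambda>p\<in>{1..n} \<times> {1..r}. X (fst p) \<omega> (snd p))) (PiE ({1..n} \<times> {1..r}) A) =
        (\<Prod>p\<in>{1..n} \<times> {1..r}. emeasure (\<mu> (snd p)) (A p))" .
  qed auto
qed

section \<open>The group of permutation families\<close>

text \<open>The direct product of \<open>r\<close> copies of the symmetric group, with
  \<open>family_comp\<close> and \<open>family_inv\<close> as its operations. Extensionality makes
  the set finite and lets equality be checked block by block.\<close>

definition perm_families :: "nat \<Rightarrow> nat \<Rightarrow> (nat \<Rightarrow> nat \<Rightarrow> nat) set" where
  "perm_families n r = PiE {1..r} (\<lambda>_. {\<tau>. \<tau> permutes {1..n}})"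

definition family_comp :: "nat \<Rightarrow> (nat \<Rightarrow> nat \<Rightarrow> nat) \<Rightarrow> (nat \<Rightarrow> nat \<Rightarrow> nat) \<Rightarrow> nat \<Rightarrow> nat \<Rightarrow> nat" where
  "family_comp r \<tau> \<pi> = (\<lambda>i\<in>{1..r}. \<tau> i \<circ> \<pi> i)"

definition family_inv :: "nat \<Rightarrow> (nat \<Rightarrow> nat \<Rightarrow> nat) \<Rightarrow> nat \<Rightarrow> nat \<Rightarrow> nat" where
  "family_inv r \<tau> = (\<lambda>i\<in>{1..r}. inv (\<tau> i))"

lemma perm_familiesD: "\<tau> \<in> perm_families n r \<Longrightarrow> i \<in> {1..r} \<Longrightarrow> \<tau> i permutes {1..n}"
  unfolding perm_families_def by blast

lemma finite_perm_families: "finite (perm_families n r)"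
  unfolding perm_families_def by (intro finite_PiE finite_permutations finite_atLeastAtMost)

lemma perm_families_nonempty: "perm_families n r \<noteq> {}"
  unfolding perm_families_def PiE_eq_empty_iff using permutes_id by blast

lemma family_comp_in:
  "\<tau> \<in> perm_families n r \<Longrightarrow> \<pi> \<in> perm_families n r \<Longrightarrow>
   family_comp r \<tau> \<pi> \<in> perm_families n r"
  unfolding perm_families_def family_comp_def
  by (intro restrict_PiE_iff[THEN iffD2] ballI CollectI permutes_compose) blast+

lemma family_inv_in: "\<tau> \<in> perm_families n r \<Longrightarrow> family_inv r \<tau> \<in> perm_families n r"
  unfolding perm_families_def family_inv_def
  by (intro restrict_PiE_iff[THEN iffD2] ballI CollectI permutes_inv) blast

lemma family_comp_cancel:
  assumes "\<tau> \<in> perm_families n r" "\<pi> \<in> perm_families n r"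
  shows "family_comp r \<tau> (family_comp r (family_inv r \<tau>) \<pi>) = \<pi>"
    and "family_comp r (family_inv r \<tau>) (family_comp r \<tau> \<pi>) = \<pi>"
    and "family_comp r (family_comp r \<tau> (family_inv r \<pi>)) \<pi> = \<tau>"
proof -
  have \<tau>: "\<tau> i permutes {1..n}" and \<pi>: "\<pi> i permutes {1..n}" if "i \<in> {1..r}" for i
    using assms that by (auto dest: perm_familiesD)
  have ext: "\<tau> \<in> extensional {1..r}" "\<pi> \<in> extensional {1..r}"
    using assms by (auto simp: perm_families_def PiE_def)
  have comp: "\<tau> i \<circ> (inv (\<tau> i) \<circ> \<pi> i) = \<pi> i" "inv (\<tau> i) \<circ> (\<tau> i \<circ> \<pi> i) = \<pi> i"
    "(\<tau> i \<circ> inv (\<pi> i)) \<circ> \<pi> i = \<tau> i" if "i \<in> {1..r}" for i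
    by (simp_all add: fun_eq_iff permutes_inverses[OF \<tau>[OF that]] permutes_inverses[OF \<pi>[OF that]])
  show "family_comp r \<tau> (family_comp r (family_inv r \<tau>) \<pi>) = \<pi>"
    using comp(1) by (intro extensionalityI[OF _ ext(2)]) (simp_all add: family_comp_def family_inv_def)
  show "family_comp r (family_inv r \<tau>) (family_comp r \<tau> \<pi>) = \<pi>"
    using comp(2) by (intro extensionalityI[OF _ ext(2)]) (simp_all add: family_comp_def family_inv_def)
  show "family_comp r (family_comp r \<tau> (family_inv r \<pi>)) \<pi> = \<tau>"
    using comp(3) by (intro extensionalityI[OF _ ext(1)]) (simp_all add: family_comp_def family_inv_def)
qed

text \<open>Left translation in a group. It serves to remove a data-dependent optimal family from a
  sum over the whole group.\<close>

lemma bij_betw_family_comp: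
  assumes "\<tau> \<in> perm_families n r"
  shows "bij_betw (family_comp r \<tau>) (perm_families n r) (perm_families n r)"
proof (rule bij_betw_byWitness[where f' = "family_comp r (family_inv r \<tau>)"])
  show "family_comp r \<tau> ` perm_families n r \<subseteq> perm_families n r"
    using family_comp_in[OF assms] by blast
  show "family_comp r (family_inv r \<tau>) ` perm_families n r \<subseteq> perm_families n r"
    using family_comp_in[OF family_inv_in[OF assms]] by blast
qed (simp_all add: family_comp_cancel[OF assms])

section \<open>The group action on arrays and the invariance of the product law\<close>

text \<open>The new array reads observation \<open>\<pi> i a\<close> in block \<open>i\<close>, so
  that optimal families are composed with \<open>\<pi>\<close> on the right. The restriction keeps
  the result in the product space.\<close>

definition permute_blocks ::
  "nat \<Rightarrow> nat \<Rightarrow> (nat \<Rightarrow> nat \<Rightarrow> nat) \<Rightarrow> (nat \<times> nat \<Rightarrow> nat \<Rightarrow> real) \<Rightarrow> nat \<times> nat \<Rightarrow> nat \<Rightarrow> real" where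
  "permute_blocks n r \<pi> z = (\<lambda>p\<in>{1..n} \<times> {1..r}. z (\<pi> (snd p) (fst p), snd p))"

lemma optimal_family_permute_iff:
  assumes "\<pi> \<in> perm_families n r"
  shows "optimal_family n r d h (permute_blocks n r \<pi> z) (family_comp r \<tau> \<pi>) \<longleftrightarrow> optimal_family n r d h z \<tau>"
  unfolding optimal_family_def
proof (rule ball_cong[OF refl])
  fix i assume i: "i \<in> {1..r}"
  show "optimal_assignment (d i) n (h (d i)) (\<lambda>a. permute_blocks n r \<pi> z (a, i)) (family_comp r \<tau> \<pi> i) \<longleftrightarrow>
      optimal_assignment (d i) n (h (d i)) (\<lambda>a. z (a, i)) (\<tau> i)"
    using optimal_assignment_permute_iff[OF perm_familiesD[OF assms i],
        of "\<lambda>a. permute_blocks n r \<pi> z (a, i)" "\<lambda>a. z (a, i)"] i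
    by (simp add: permute_blocks_def family_comp_def)
qed

lemma optimal_family_exists: "\<exists>\<tau>\<in>perm_families n r. optimal_family n r d h z \<tau>"
proof -
  have "\<forall>i. \<exists>\<tau>. optimal_assignment (d i) n (h (d i)) (\<lambda>a. z (a, i)) \<tau>"
    by (intro allI optimal_assignment_exists)
  from choice[OF this] obtain \<tau>
    where \<tau>: "\<And>i. optimal_assignment (d i) n (h (d i)) (\<lambda>a. z (a, i)) (\<tau> i)" by blast
  then have "\<tau> i permutes {1..n}" for i
    unfolding optimal_assignment_def is_arg_min_def by blast
  then have "restrict \<tau> {1..r} \<in> perm_families n r"
    unfolding perm_families_def by simp
  moreover have "optimal_family n r d h z (restrict \<tau> {1..r})"
    using \<tau> by (simp add: optimal_family_def)
  ultimately show ?thesis by blast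
qed

text \<open>For a fixed family, optimality is a finite conjunction of inequalities between costs,
  which are polynomials in the coordinates.\<close>

lemma sets_optimal_family:
  assumes \<mu>: "\<And>i. i \<in> {1..r} \<Longrightarrow> sets (\<mu> i) = sets (lebesgue_R (d i))"
  shows "{z \<in> space (PiM ({1..n} \<times> {1..r}) (\<lambda>p. \<mu> (snd p))). optimal_family n r d h z \<tau>}
           \<in> sets (PiM ({1..n} \<times> {1..r}) (\<lambda>p. \<mu> (snd p)))" (is "_ \<in> sets ?\<nu>")
proof -
  have cost: "(\<lambda>z. \<Sum>a=1..n. (norm_R (d i) (\<lambda>k. z (a, i) k - h (d i) (\<rho> a) k))\<^sup>2) \<in> borel_measurable ?\<nu>"
    if "i \<in> {1..r}" for i \<rho>
    unfolding norm_R_power2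
    by (intro borel_measurable_sum borel_measurable_power borel_measurable_diff borel_measurable_const
        measurable_block_coordinate[where \<mu> = \<mu>, OF that \<mu>[OF that]]) simp_all
  have "{z \<in> space ?\<nu>. \<forall>i\<in>{1..r}. \<tau> i permutes {1..n} \<and> (\<forall>\<rho>\<in>{\<rho>. \<rho> permutes {1..n}}.
      (\<Sum>a=1..n. (norm_R (d i) (\<lambda>k. z (a, i) k - h (d i) (\<tau> i a) k))\<^sup>2) \<le>
      (\<Sum>a=1..n. (norm_R (d i) (\<lambda>k. z (a, i) k - h (d i) (\<rho> a) k))\<^sup>2))} \<in> sets ?\<nu>"
    by (intro sets.sets_Collect_finite_All sets.sets_Collect_conj sets.sets_Collect_const
        borel_measurable_le[OF cost cost] finite_permutations finite_atLeastAtMost)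
  then show ?thesis
    by (simp only: optimal_family_def optimal_assignment_def is_arg_min_linorder Ball_def mem_Collect_eq)
qed

lemma
  fixes r :: nat
  assumes prob: "\<And>i. prob_space (\<mu> i)" and \<pi>: "\<pi> \<in> perm_families n r"
  shows measurable_permute_blocks:
      "permute_blocks n r \<pi> \<in> measurable (PiM ({1..n} \<times> {1..r}) (\<lambda>p. \<mu> (snd p)))
                                        (PiM ({1..n} \<times> {1..r}) (\<lambda>p. \<mu> (snd p)))" (is "_ \<in> measurable ?\<nu> _")
    and distr_permute_blocks:
      "distr (PiM ({1..n} \<times> {1..r}) (\<lambda>p. \<mu> (snd p))) (PiM ({1..n} \<times> {1..r}) (\<lambda>p. \<mu> (snd p)))
         (permute_blocks n r \<pi>) = PiM ({1..n} \<times> {1..r}) (\<lambda>p. \<mu> (snd p))"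
proof -
  \<comment> \<open>This reindexing keeps the block index, hence the factor law, and is injective
    because each \<open>\<pi> i\<close> is. An injective reindexing between equal factors preserves
    the product measure.\<close>
  let ?f = "\<lambda>p. (\<pi> (snd p) (fst p), snd p)"
  have f: "?f p \<in> {1..n} \<times> {1..r}" if "p \<in> {1..n} \<times> {1..r}" for p
    using that permutes_in_image[OF perm_familiesD[OF \<pi>]] by (simp add: mem_Times_iff)
  have inj: "inj_on ?f ({1..n} \<times> {1..r})"
  proof (rule inj_onI)
    fix p q assume "p \<in> {1..n} \<times> {1..r}" and eq: "?f p = ?f q"
    then have "inj (\<pi> (snd p))"
      by (intro permutes_inj[OF perm_familiesD[OF \<pi>]]) (simp only: mem_Times_iff)
    moreover have "snd p = snd q" "\<pi> (snd p) (fst p) = \<pi> (snd p) (fst q)"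
      using eq by auto
    ultimately show "p = q"
      by (simp only: inj_eq prod_eq_iff)
  qed
  show "permute_blocks n r \<pi> \<in> measurable ?\<nu> ?\<nu>"
    unfolding permute_blocks_def[abs_def]
  proof (rule measurable_restrict)
    fix p assume "p \<in> {1..n} \<times> {1..r}"
    from measurable_component_singleton[OF f[OF this], of "\<lambda>p. \<mu> (snd p)"]
    show "(\<lambda>z. z (?f p)) \<in> measurable ?\<nu> (\<mu> (snd p))" by simp
  qed
  show "distr ?\<nu> ?\<nu> (permute_blocks n r \<pi>) = ?\<nu>"
    using distr_PiM_reindex[of "{1..n} \<times> {1..r}" "\<lambda>p. \<mu> (snd p)" ?f "{1..n} \<times> {1..r}", OF prob inj Pi_I[OF f]]
    unfolding permute_blocks_def[abs_def] snd_conv .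
qed

section \<open>Averaging over the group\<close>

text \<open>The event quantifies over all optimal families, which avoids choosing a measurable
  minimizer. Its translates by the group are equally likely, and almost every \<open>z\<close> lies
  in the same number of them, so its probability is that number divided by the order of the
  group.\<close>

lemma measure_optimal_family:
  fixes F :: "(nat \<Rightarrow> nat \<Rightarrow> nat) \<Rightarrow> 'c"
  assumes prob: "\<And>i. prob_space (\<mu> i)"
    and \<mu>: "\<And>i. i \<in> {1..r} \<Longrightarrow> ac_distribution (d i) (\<mu> i)"
    and F: "\<And>\<tau> \<tau>'. (\<And>i a k. i \<in> {1..r} \<Longrightarrow> a \<in> {1..n} \<Longrightarrow> k < d i \<Longrightarrow> h (d i) (\<tau> i a) k = h (d i) (\<tau>' i a) k)
              \<Longrightarrow> F \<tau> = F \<tau>'"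
  defines "\<nu> \<equiv> PiM ({1..n} \<times> {1..r}) (\<lambda>p. \<mu> (snd p))"
  shows "measure \<nu> {z \<in> space \<nu>. \<exists>\<tau>\<in>perm_families n r. optimal_family n r d h z \<tau> \<and> F \<tau> \<in> B} =
           (\<Sum>\<pi>\<in>perm_families n r. indicator B (F \<pi>)) / card (perm_families n r)"
    (is "measure \<nu> ?E = _")
proof -
  let ?P = "perm_families n r"
  interpret \<nu>: prob_space \<nu>
    unfolding \<nu>_def by (intro prob_space_PiM prob)
  \<comment> \<open>The translate by \<open>\<pi>\<close>; it will turn out to be the preimage of
    \<open>?E\<close> under the action of \<open>\<pi>\<close>, hence of equal probability.\<close>
  define E where "E \<pi> = {z \<in> space \<nu>. \<exists>\<tau>\<in>?P. optimal_family n r d h z \<tau> \<and> F (family_comp r \<tau> \<pi>) \<in> B}" for \<pi>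
  have sets: "{z \<in> space \<nu>. \<exists>\<tau>\<in>?P. optimal_family n r d h z \<tau> \<and> Q \<tau>} \<in> sets \<nu>" for Q
    unfolding \<nu>_def
    by (intro sets.sets_Collect_finite_Ex finite_perm_families sets.sets_Collect_conj
        sets.sets_Collect_const sets_optimal_family sets_ac_distribution \<mu>)
  have meas: "measure \<nu> (E \<pi>) = measure \<nu> ?E" if \<pi>: "\<pi> \<in> ?P" for \<pi>
  proof -
    note T = measurable_permute_blocks[where \<mu> = \<mu>, OF prob \<pi>, folded \<nu>_def]
    have "permute_blocks n r \<pi> -` ?E \<inter> space \<nu> = E \<pi>"
    proof (intro set_eqI iffI)
      fix z assume "z \<in> permute_blocks n r \<pi> -` ?E \<inter> space \<nu>"
      then obtain \<tau> where \<tau>: "\<tau> \<in> ?P" "optimal_family n r d h (permute_blocks n r \<pi> z) \<tau>" "F \<tau> \<in> B"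
        and z: "z \<in> space \<nu>" by blast
      \<comment> \<open>Undoing the translation: if \<open>\<tau>\<close> is optimal for the
        permuted array, this family is optimal for \<open>z\<close>.\<close>
      let ?\<rho> = "family_comp r \<tau> (family_inv r \<pi>)"
      have "family_comp r ?\<rho> \<pi> = \<tau>"
        using family_comp_cancel(3)[OF \<tau>(1) \<pi>] .
      moreover from this have "optimal_family n r d h z ?\<rho>"
        using \<tau>(2) optimal_family_permute_iff[OF \<pi>, of d h z ?\<rho>] by simp
      moreover have "?\<rho> \<in> ?P"
        by (intro family_comp_in family_inv_in \<tau> \<pi>)
      ultimately show "z \<in> E \<pi>"
        unfolding E_def using z \<tau>(3) by force
    next
      fix z assume "z \<in> E \<pi>"
      then obtain \<tau> where \<tau>: "\<tau> \<in> ?P" "optimal_family n r d h z \<tau>" "F (family_comp r \<tau> \<pi>) \<in> B"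
        and z: "z \<in> space \<nu>" unfolding E_def by blast
      then have "optimal_family n r d h (permute_blocks n r \<pi> z) (family_comp r \<tau> \<pi>)"
        using optimal_family_permute_iff[OF \<pi>] by blast
      then show "z \<in> permute_blocks n r \<pi> -` ?E \<inter> space \<nu>"
        using z \<tau> family_comp_in[OF \<tau>(1) \<pi>] measurable_space[OF T z] by blast
    qed
    then show ?thesis
      using measure_distr[OF T sets, of "\<lambda>\<tau>. F \<tau> \<in> B"] distr_permute_blocks[where \<mu> = \<mu>, OF prob \<pi>, folded \<nu>_def]
      by simp
  qed
  have uniq: "AE z in \<nu>. unique_optimal_ranks n r d h z"
    unfolding \<nu>_def using \<mu> by (rule AE_optimal_ranks_unique)
  have sum: "AE z in \<nu>. (\<Sum>\<pi>\<in>?P. indicator (E \<pi>) z) = (\<Sum>\<pi>\<in>?P. indicator B (F \<pi>) :: real)"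
    using uniq AE_space
  proof eventually_elim
    fix z
    assume uniq: "unique_optimal_ranks n r d h z" and z: "z \<in> space \<nu>"
    obtain \<tau> where \<tau>: "\<tau> \<in> ?P" "optimal_family n r d h z \<tau>"
      using optimal_family_exists by blast
    \<comment> \<open>Two optimal families have the same ranks at all observations, in particular at
      \<open>\<pi> i a\<close>, so their translates have the same ranks too.\<close>
    have eq: "F (family_comp r \<tau>' \<pi>) = F (family_comp r \<tau> \<pi>)"
      if "optimal_family n r d h z \<tau>'" and \<pi>: "\<pi> \<in> ?P" for \<tau>' \<pi>
    proof (rule F)
      fix i a k assume iak: "i \<in> {1..r}" "a \<in> {1..n}" "k < d i"
      have "\<pi> i a \<in> {1..n}"
        using permutes_in_image[OF perm_familiesD[OF \<pi> iak(1)]] iak(2) by simp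
      then have "h (d i) (\<tau>' i (\<pi> i a)) k = h (d i) (\<tau> i (\<pi> i a)) k"
        using uniq that(1) \<tau>(2) iak unfolding unique_optimal_ranks_def by blast
      then show "h (d i) (family_comp r \<tau>' \<pi> i a) k = h (d i) (family_comp r \<tau> \<pi> i a) k"
        using iak(1) by (simp add: family_comp_def)
    qed
    have "z \<in> E \<pi> \<longleftrightarrow> F (family_comp r \<tau> \<pi>) \<in> B" if \<pi>: "\<pi> \<in> ?P" for \<pi>
    proof
      assume "z \<in> E \<pi>"
      then obtain \<tau>' where "optimal_family n r d h z \<tau>'" "F (family_comp r \<tau>' \<pi>) \<in> B"
        unfolding E_def by blast
      then show "F (family_comp r \<tau> \<pi>) \<in> B" by (simp only: eq[OF _ \<pi>])
    next
      assume "F (family_comp r \<tau> \<pi>) \<in> B"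
      then show "z \<in> E \<pi>" unfolding E_def using z \<tau> by blast
    qed
    then have "(\<Sum>\<pi>\<in>?P. indicator (E \<pi>) z) = (\<Sum>\<pi>\<in>?P. indicator B (F (family_comp r \<tau> \<pi>)) :: real)"
      by (intro sum.cong refl) (simp add: indicator_def)
    \<comment> \<open>As \<open>\<pi>\<close> runs through the group, so does the translate of
      \<open>\<pi>\<close> by \<open>\<tau>\<close>; the dependence on \<open>z\<close>
      disappears.\<close>
    also have "\<dots> = (\<Sum>\<pi>\<in>?P. indicator B (F \<pi>))"
      by (rule sum.reindex_bij_betw[OF bij_betw_family_comp[OF \<tau>(1)]])
    finally show "(\<Sum>\<pi>\<in>?P. indicator (E \<pi>) z) = (\<Sum>\<pi>\<in>?P. indicator B (F \<pi>) :: real)" .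
  qed
  have E_sets: "E \<pi> \<in> sets \<nu>" for \<pi>
    unfolding E_def by (rule sets)
  \<comment> \<open>Double counting: the expected number of translates containing \<open>z\<close>
    is computed once term by term and once from its almost sure constant value.\<close>
  have "card ?P * measure \<nu> ?E = (\<Sum>\<pi>\<in>?P. measure \<nu> (E \<pi>))"
    by (simp add: meas)
  also have "\<dots> = (\<Sum>\<pi>\<in>?P. \<integral>z. indicator (E \<pi>) z \<partial>\<nu>)"
    using E_sets by (intro sum.cong refl) simp
  also have "\<dots> = (\<integral>z. (\<Sum>\<pi>\<in>?P. indicator (E \<pi>) z) \<partial>\<nu>)"
    using E_sets by (intro Bochner_Integration.integral_sum[symmetric] \<nu>.integrable_const_bound[where B = 1])
      (auto simp: indicator_def)
  also have "\<dots> = (\<integral>z. (\<Sum>\<pi>\<in>?P. indicator B (F \<pi>)) \<partial>\<nu>)"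
    using E_sets sum by (intro integral_cong_AE) auto
  also have "\<dots> = (\<Sum>\<pi>\<in>?P. indicator B (F \<pi>))"
    by (simp add: \<nu>.prob_space)
  finally show ?thesis
    using perm_families_nonempty finite_perm_families by (simp add: field_simps card_gt_0_iff)
qed

section \<open>Law of the statistic and its universality\<close>

text \<open>The given minimizers have almost surely the same ranks as every other optimal family.
  The event for the statistic is therefore almost surely the pullback of the canonical event, whose
  probability is the uniform average on the right.\<close>

lemma
  assumes n: "n \<ge> 1" and \<mu>: "\<And>i. i \<in> {1..r} \<Longrightarrow> ac_distribution (d i) (\<mu> i)"
    and X: "iid_product_sample M n r d \<mu> X" and \<sigma>: "optimal_assignments M n r d h X \<sigma>"
  shows measurable_RJdCov2_stat: "RJdCov2_stat n r d h C \<sigma> \<in> measurable M (count_space UNIV)" (is ?meas)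
    and measure_RJdCov2_stat: "measure M (RJdCov2_stat n r d h C \<sigma> -` B \<inter> space M) =
      (\<Sum>\<pi>\<in>perm_families n r. indicator B (RJdCov2 n r d C (\<lambda>i a. h (d i) (\<pi> i a)))) / card (perm_families n r)"
      (is "measure M ?S = _")
proof -
  let ?P = "perm_families n r" and ?F = "\<lambda>\<tau>. RJdCov2 n r d C (\<lambda>i a. h (d i) (\<tau> i a))"
  \<comment> \<open>The canonical-space lemmas ask for a probability measure at every index. A point
    mass is put outside \<open>{1..r}\<close>; the product over \<open>{1..r}\<close> stays the
    same.\<close>
  define \<mu>' where "\<mu>' i = (if i \<in> {1..r} then \<mu> i else return (count_space UNIV) undefined)" for i
  have prob: "prob_space (\<mu>' i)" for i
    using \<mu>[of i] by (auto simp: \<mu>'_def ac_distribution_def intro: prob_space_return)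
  have \<mu>': "ac_distribution (d i) (\<mu>' i)" if "i \<in> {1..r}" for i
    using \<mu>[OF that] that by (simp add: \<mu>'_def)
  have "PiM {1..r} \<mu> = PiM {1..r} \<mu>'"
    by (rule PiM_cong) (simp_all add: \<mu>'_def)
  with X have X': "iid_product_sample M n r d \<mu>' X"
    by (simp add: iid_product_sample_def)
  define \<nu> where "\<nu> = PiM ({1..n} \<times> {1..r}) (\<lambda>p. \<mu>' (snd p))"
  define Z where "Z \<omega> = (\<lambda>p\<in>{1..n} \<times> {1..r}. X (fst p) \<omega> (snd p))" for \<omega>
  have Z: "Z \<in> measurable M \<nu>" and law: "distr M \<nu> Z = \<nu>"
    using measurable_sample_blocks[OF X' n prob sets_ac_distribution[OF \<mu>']]
      distr_sample_blocks[OF X' n prob sets_ac_distribution[OF \<mu>']]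
    unfolding \<nu>_def Z_def[abs_def] by simp_all
  \<comment> \<open>Restriction to \<open>{1..r}\<close> turns the random minimizers into a random
    element of the finite group.\<close>
  define \<tau> where "\<tau> \<omega> = (\<lambda>i\<in>{1..r}. \<sigma> i \<omega>)" for \<omega>
  have opt: "optimal_assignment (d i) n (h (d i)) (\<lambda>a. X a \<omega> i) (\<sigma> i \<omega>)"
    if "i \<in> {1..r}" "\<omega> \<in> space M" for i \<omega>
    using \<sigma> that unfolding optimal_assignments_def by blast
  have \<tau>_in: "\<tau> \<omega> \<in> ?P" if "\<omega> \<in> space M" for \<omega>
    using opt[OF _ that] unfolding perm_families_def \<tau>_def restrict_PiE_iff optimal_assignment_def is_arg_min_def
    by blast
  have \<tau>_opt: "optimal_family n r d h (Z \<omega>) (\<tau> \<omega>)" if "\<omega> \<in> space M" for \<omega>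
    unfolding optimal_family_def
  proof
    fix i assume i: "i \<in> {1..r}"
    show "optimal_assignment (d i) n (h (d i)) (\<lambda>a. Z \<omega> (a, i)) (\<tau> \<omega> i)"
      using opt[OF i that] i optimal_assignment_cong[of n "\<lambda>a. Z \<omega> (a, i)" "\<lambda>a. X a \<omega> i"]
      by (simp add: Z_def \<tau>_def)
  qed
  have stat: "RJdCov2_stat n r d h C \<sigma> \<omega> = ?F (\<tau> \<omega>)" for \<omega>
    unfolding RJdCov2_stat_def by (rule RJdCov2_cong) (simp add: \<tau>_def)
  have \<tau>_sets: "{\<omega> \<in> space M. \<tau> \<omega> = \<rho>} \<in> sets M" if "\<rho> \<in> ?P" for \<rho>
  proof -
    have "\<rho> \<in> extensional {1..r}"
      using that by (auto simp: perm_families_def PiE_def)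
    then have "\<tau> \<omega> = \<rho> \<longleftrightarrow> (\<forall>i\<in>{1..r}. \<sigma> i \<omega> = \<rho> i)" for \<omega>
      unfolding \<tau>_def by (auto simp: fun_eq_iff extensional_def)
    moreover have "{\<omega> \<in> space M. \<sigma> i \<omega> = \<rho> i} \<in> sets M" if "i \<in> {1..r}" for i
      using \<sigma> that measurable_sets[of "\<sigma> i" M "count_space UNIV" "{\<rho> i}"]
      by (simp add: optimal_assignments_def vimage_def Int_def conj_commute)
    ultimately show ?thesis
      by (simp only:) (intro sets.sets_Collect_finite_All, simp_all)
  qed
  \<comment> \<open>The statistic factors through \<open>\<tau>\<close>, which has finitely many
    values, so the preimage of any set at all is a finite union of measurable level sets.\<close>
  have S: "RJdCov2_stat n r d h C \<sigma> -` A \<inter> space M = (\<Union>\<rho>\<in>{\<rho>\<in>?P. ?F \<rho> \<in> A}. {\<omega> \<in> space M. \<tau> \<omega> = \<rho>})" for A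
    using \<tau>_in by (auto simp: stat)
  have S_sets: "RJdCov2_stat n r d h C \<sigma> -` A \<inter> space M \<in> sets M" for A
    unfolding S by (intro sets.finite_UN) (auto intro: \<tau>_sets simp: finite_perm_families)
  then show ?meas
    by (intro measurableI) simp_all
  let ?E = "{z \<in> space \<nu>. \<exists>\<tau>\<in>?P. optimal_family n r d h z \<tau> \<and> ?F \<tau> \<in> B}"
  have E: "?E \<in> sets \<nu>"
    unfolding \<nu>_def
    by (intro sets.sets_Collect_finite_Ex finite_perm_families sets.sets_Collect_conj
        sets.sets_Collect_const sets_optimal_family sets_ac_distribution \<mu>')
  have "AE z in distr M \<nu> Z. unique_optimal_ranks n r d h z"
    unfolding law unfolding \<nu>_def using \<mu>' by (rule AE_optimal_ranks_unique)
  \<comment> \<open>The two events can differ only where the optimal ranks are not unique.\<close>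
  from AE_distrD[OF Z this] AE_space have "AE \<omega> in M. \<omega> \<in> ?S \<longleftrightarrow> \<omega> \<in> Z -` ?E \<inter> space M"
  proof eventually_elim
    fix \<omega>
    assume uniq: "unique_optimal_ranks n r d h (Z \<omega>)" and \<omega>: "\<omega> \<in> space M"
    have eq: "?F \<rho> = ?F (\<tau> \<omega>)" if "optimal_family n r d h (Z \<omega>) \<rho>" for \<rho>
    proof (rule RJdCov2_cong)
      fix i a k assume iak: "i \<in> {1..r}" "a \<in> {1..n}" "k < d i"
      then show "h (d i) (\<rho> i a) k = h (d i) (\<tau> \<omega> i a) k"
        using uniq that \<tau>_opt[OF \<omega>] unfolding unique_optimal_ranks_def by blast
    qed
    have "Z \<omega> \<in> ?E \<longleftrightarrow> ?F (\<tau> \<omega>) \<in> B"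
    proof
      assume "Z \<omega> \<in> ?E"
      then obtain \<rho> where "optimal_family n r d h (Z \<omega>) \<rho>" "?F \<rho> \<in> B" by blast
      then show "?F (\<tau> \<omega>) \<in> B" by (simp only: eq)
    next
      assume "?F (\<tau> \<omega>) \<in> B"
      then show "Z \<omega> \<in> ?E"
        using \<tau>_in[OF \<omega>] \<tau>_opt[OF \<omega>] measurable_space[OF Z \<omega>] by blast
    qed
    then show "\<omega> \<in> ?S \<longleftrightarrow> \<omega> \<in> Z -` ?E \<inter> space M"
      using \<omega> by (simp only: Int_iff vimage_eq stat)
  qed
  then have "measure M ?S = measure M (Z -` ?E \<inter> space M)"
    by (rule measure_eq_AE) (use S_sets measurable_sets[OF Z E] in simp_all)
  also have "\<dots> = measure \<nu> ?E"
    using measure_distr[OF Z E] law by simp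
  also have "\<dots> = (\<Sum>\<pi>\<in>?P. indicator B (?F \<pi>)) / card ?P"
    unfolding \<nu>_def
  proof (rule measure_optimal_family[OF prob])
    fix \<rho> \<rho>'
    assume "\<And>i a k. i \<in> {1..r} \<Longrightarrow> a \<in> {1..n} \<Longrightarrow> k < d i \<Longrightarrow> h (d i) (\<rho> i a) k = h (d i) (\<rho>' i a) k"
    then show "?F \<rho> = ?F \<rho>'" by (rule RJdCov2_cong)
  qed (rule \<mu>')
  finally show "measure M ?S = (\<Sum>\<pi>\<in>?P. indicator B (?F \<pi>)) / card ?P" .
qed

theorem proposition3p1:
  fixes M :: "'a measure" and M' :: "'b measure"
    and n r :: nat and d :: "nat \<Rightarrow> nat"
    and h :: "nat \<Rightarrow> nat \<Rightarrow> nat \<Rightarrow> real" and C :: "nat \<Rightarrow> real"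
    and \<mu> \<mu>' :: "nat \<Rightarrow> (nat \<Rightarrow> real) measure"
    and X :: "nat \<Rightarrow> 'a \<Rightarrow> nat \<Rightarrow> nat \<Rightarrow> real" and X' :: "nat \<Rightarrow> 'b \<Rightarrow> nat \<Rightarrow> nat \<Rightarrow> real"
    and \<sigma> :: "nat \<Rightarrow> 'a \<Rightarrow> nat \<Rightarrow> nat" and \<sigma>' :: "nat \<Rightarrow> 'b \<Rightarrow> nat \<Rightarrow> nat"
  assumes "n \<ge> 1"
    and "\<And>i. i \<in> {1..r} \<Longrightarrow> d i \<ge> 1"
    and "\<And>i j. i \<in> {1..r} \<Longrightarrow> j \<in> {1..n} \<Longrightarrow> h (d i) j \<in> {..<d i} \<rightarrow>\<^sub>E {0..1}"
    and "\<And>s. s \<in> {2..r} \<Longrightarrow> C s \<ge> 0"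
    and "\<And>i. i \<in> {1..r} \<Longrightarrow> ac_distribution (d i) (\<mu> i)"
    and "iid_product_sample M n r d \<mu> X"
    and "optimal_assignments M n r d h X \<sigma>"
    and "\<And>i. i \<in> {1..r} \<Longrightarrow> ac_distribution (d i) (\<mu>' i)"
    and "iid_product_sample M' n r d \<mu>' X'"
    and "optimal_assignments M' n r d h X' \<sigma>'"
  shows "RJdCov2_stat n r d h C \<sigma> \<in> borel_measurable M \<and>
         RJdCov2_stat n r d h C \<sigma>' \<in> borel_measurable M' \<and>
         distr M borel (RJdCov2_stat n r d h C \<sigma>) = distr M' borel (RJdCov2_stat n r d h C \<sigma>')"
proof (intro conjI)
  let ?T = "RJdCov2_stat n r d h C \<sigma>" and ?T' = "RJdCov2_stat n r d h C \<sigma>'"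
  interpret M: prob_space M using assms(6) by (simp add: iid_product_sample_def)
  interpret M': prob_space M' using assms(9) by (simp add: iid_product_sample_def)
  have id: "(\<lambda>x. x) \<in> borel_measurable (count_space (UNIV :: real set))"
    by (simp add: measurable_count_space_eq1)
  have "?T \<in> measurable M (count_space UNIV)"
    using assms(1,5-7) by (rule measurable_RJdCov2_stat)
  from measurable_compose[OF this id] show T: "?T \<in> borel_measurable M" .
  have "?T' \<in> measurable M' (count_space UNIV)"
    using assms(1,8-10) by (rule measurable_RJdCov2_stat)
  from measurable_compose[OF this id] show T': "?T' \<in> borel_measurable M'" .
  show "distr M borel ?T = distr M' borel ?T'"
  proof (rule measure_eqI)
    fix B assume "B \<in> sets (distr M borel ?T)"
    then have B: "B \<in> sets borel" by simp
    \<comment> \<open>Both sides equal one average over \<open>perm_families n r\<close>, which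
      contains \<open>n\<close>, \<open>r\<close>, \<open>d\<close>, \<open>h\<close>,
      \<open>C\<close> and \<open>B\<close> but neither the block laws nor the samples nor the
      chosen minimizers.\<close>
    have "measure M (?T -` B \<inter> space M) = measure M' (?T' -` B \<inter> space M')"
      by (simp only: measure_RJdCov2_stat[OF assms(1,5,6,7)] measure_RJdCov2_stat[OF assms(1,8,9,10)])
    then show "emeasure (distr M borel ?T) B = emeasure (distr M' borel ?T') B"
      by (simp add: emeasure_distr[OF T B] emeasure_distr[OF T' B] M.emeasure_eq_measure M'.emeasure_eq_measure)
  qed simp
qed

end
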